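(* Let $(x^k)_{k\in\mathbb{N}}$ be the infinite sequence generated by the M-FW algorithm. Assume that $\mathcal{X}$ is $(\alpha,q)$-uniformly convex for some $\alpha>0$ and $q\ge2$, and that $c:=\inf_{k}|\tilde\theta(x^k)|>0$, where $\tilde\theta(x):=\min_{\|z\|\le1}\max_{j\in\mathcal{J}}\langle\nabla F_j(x),z\rangle$. Let $$\zeta:=\frac{[\alpha c]^{2/q}}{2^{(4+q)/q}},$$ and, for $q>2$, $$k_0:=\max\left\{\left\lfloor\frac{2}{q-2}\log_2\left(\frac{2D_{\mathcal{X}}^{q-2}\zeta^{q/2}}{L}\right)\right\rfloor+2,\;1\right\}.$$ Then $$\hat h(x^k)\le\begin{cases}\left[\max\left\{\frac12,\,1-\frac{\zeta}{L}\right\}\right]\hat h(x^{k-1}),&\text{for }q=2,\ k\ge1,\\[2mm]\dfrac{L D_{\mathcal{X}}^2}{2^k},&\text{for }q>2,\ 1\le k\le k_0,\\[2mm]\left(\dfrac{qL}{\zeta[2q+(q-2)(k-k_0)]}\right)^{\frac{q}{q-2}}=\mathcal{O}\left(1/k^{\frac{q}{q-2}}\right),&\text{for }q>2,\ k>k_0,\end{cases}$$ and $$\sum_{i=\ell}^{k}\min\left\{|\theta^{FW}(x^i)|,\frac{|\theta^{FW}(x^i)|^2}{L\|d^{FW}(x^i)\|^2}\right\}\le 2\hat h(x^\ell),\qquad\forall k\ge \ell\ge 1.$$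
   Context: Setting. $\mathcal{Y}$ is a finite-dimensional real vector space with an inner product $\langle\cdot,\cdot\rangle$ and a norm $\|\cdot\|$ (not necessarily induced by the inner product); gradients are taken with respect to $\langle\cdot,\cdot\rangle$. $\mathcal{X}\subset\mathcal{Y}$ is nonempty, convex and compact, $D_{\mathcal{X}}:=\max\{\|x-y\|:x,y\in\mathcal{X}\}$, $\mathcal{J}:=\{1,\dots,m\}$, and the problem is $\min_{x\in\mathcal{X}}F(x)=(F_1(x),\dots,F_m(x))$. Standing assumption: for every $j\in\mathcal{J}$, $F_j:V\to\mathbb{R}$ is convex and continuously differentiable ($V\subset\mathcal{Y}$ an open set containing $\mathcal{X}$) and $L_j$-smooth over $\mathcal{X}$, i.e. $$F_j(x)+\langle\nabla F_j(x),y-x\rangle\le F_j(y)\le F_j(x)+\langle\nabla F_j(x),y-x\rangle+\tfrac{L_j}{2}\|y-x\|^2\quad\forall x,y\in\mathcal{X}.$$ Set $L:=\max_{j\in\mathcal{J}}L_j>0$. $\mathbb{N}$ contains $0$. Multiobjective Frank-Wolfe (M-FW) algorithm. Start from $x^0\in\mathcal{X}$. At iteration $k$ choose $p^{FW}(x^k)\in\arg\min_{y\in\mathcal{X}}\max_{j\in\mathcal{J}}\langle\nabla F_j(x^k),y-x^k\rangle$, and let $d^{FW}(x^k):=p^{FW}(x^k)-x^k$, $\theta^{FW}(x^k):=\max_{j\in\mathcal{J}}\langle\nabla F_j(x^k),d^{FW}(x^k)\rangle$ (always $\le 0$). If $\theta^{FW}(x^k)=0$, stop. Otherwise set $\gamma_k:=\min\left\{1,\frac{-\theta^{FW}(x^k)}{L\|d^{FW}(x^k)\|^2}\right\}$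 and $x^{k+1}:=x^k+\gamma_k d^{FW}(x^k)$. It is assumed that the algorithm never stops, so it generates an infinite sequence $(x^k)_{k\in\mathbb{N}}$ with $\theta^{FW}(x^k)<0$ for all $k$. Fix a limit point $x^*$ of $(x^k)_{k\in\mathbb{N}}$ and define $h_j(x^k):=F_j(x^k)-F_j(x^* )$ and $\hat h(x^k):=\min_{j\in\mathcal{J}}h_j(x^k)$. (For every $j$ the value $F_j(x^* )=\lim_k F_j(x^k)$ does not depend on the chosen limit point.) For $\alpha>0$, $q\ge2$, the set $\mathcal{X}$ is $(\alpha,q)$-uniformly convex if for all $x,y\in\mathcal{X}$, $\gamma\in[0,1]$ and $z\in\mathcal{Y}$ with $\|z\|\le1$, one has $x+\gamma(y-x)+\gamma(1-\gamma)\frac{\alpha}{2}\|y-x\|^q z\in\mathcal{X}$. *)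

theory Defs
  imports "HOL-Analysis.Analysis" "HOL-Library.Landau_Symbols"
begin

text \<open>
  The ambient space is a \<^class>\<open>euclidean_space\<close>: its \<open>\<bullet>\<close> is the given inner product, with respect
  to which gradients are taken.  The second norm \<open>N\<close> need not be the one induced by \<open>\<bullet>\<close>; since all
  norms on a finite-dimensional space are equivalent, \<^const>\<open>open\<close>, \<^const>\<open>compact\<close> and convergence do
  not depend on which of the two is used.
\<close>

definition is_norm :: "('a::real_vector \<Rightarrow> real) \<Rightarrow> bool" where
  "is_norm N \<longleftrightarrow>
     (\<forall>x. 0 \<le> N x) \<and> (\<forall>x. N x = 0 \<longleftrightarrow> x = 0) \<and>
     (\<forall>a x. N (a *\<^sub>R x) = \<bar>a\<bar> * N x) \<and> (\<forall>x y. N (x + y) \<le> N x + N y)"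

text \<open>For compact nonempty \<open>X\<close> the supremum is a maximum; \<^const>\<open>Max\<close> itself is only
  meaningful for finite sets.\<close>

definition norm_diameter :: "('a::real_vector \<Rightarrow> real) \<Rightarrow> 'a set \<Rightarrow> real" where
  "norm_diameter N X = (SUP (x, y)\<in>X \<times> X. N (x - y))"

text \<open>The domain \<open>V\<close> is not required to be convex, whereas \<^term>\<open>convex_on V f\<close> includes
  \<^term>\<open>convex V\<close>.  Convexity of \<open>f\<close> on \<open>V\<close> is therefore taken to mean convexity on every convex
  subset; for convex \<open>V\<close> this is just \<^term>\<open>convex_on V f\<close>.\<close>

definition convex_fun_on :: "'a::real_vector set \<Rightarrow> ('a \<Rightarrow> real) \<Rightarrow> bool" where
  "convex_fun_on V f \<longleftrightarrow> (\<forall>C\<subseteq>V. convex C \<longrightarrow> convex_on C f)"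

definition cont_diff_with_gradient ::
    "'a::euclidean_space set \<Rightarrow> ('a \<Rightarrow> real) \<Rightarrow> ('a \<Rightarrow> 'a) \<Rightarrow> bool" where
  "cont_diff_with_gradient V f g \<longleftrightarrow> (\<forall>x\<in>V. GDERIV f x :> g x) \<and> continuous_on V g"

definition smooth_over ::
    "('a::euclidean_space \<Rightarrow> real) \<Rightarrow> 'a set \<Rightarrow> ('a \<Rightarrow> real) \<Rightarrow> ('a \<Rightarrow> 'a) \<Rightarrow> real \<Rightarrow> bool" where
  "smooth_over N X f g l \<longleftrightarrow>
     (\<forall>x\<in>X. \<forall>y\<in>X. f x + g x \<bullet> (y - x) \<le> f y \<and>
        f y \<le> f x + g x \<bullet> (y - x) + l / 2 * (N (y - x))\<^sup>2)"

definition uniformly_convex_set ::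
    "('a::real_vector \<Rightarrow> real) \<Rightarrow> real \<Rightarrow> real \<Rightarrow> 'a set \<Rightarrow> bool" where
  "uniformly_convex_set N \<alpha> q X \<longleftrightarrow>
     (\<forall>x\<in>X. \<forall>y\<in>X. \<forall>\<gamma>\<in>{0..1}. \<forall>z. N z \<le> 1 \<longrightarrow>
        x + \<gamma> *\<^sub>R (y - x) + (\<gamma> * (1 - \<gamma>) * (\<alpha> / 2) * N (y - x) powr q) *\<^sub>R z \<in> X)"

text \<open>Below, \<open>g j x\<close> is the gradient of the \<open>j\<close>-th objective at \<open>x\<close>, for \<open>j \<in> {1..m}\<close>.\<close>

definition max_slope :: "nat \<Rightarrow> (nat \<Rightarrow> 'a::euclidean_space \<Rightarrow> 'a) \<Rightarrow> 'a \<Rightarrow> 'a \<Rightarrow> real" where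
  "max_slope m g x d = (MAX j\<in>{1..m}. g j x \<bullet> d)"

text \<open>The infimum over the unit ball of \<open>N\<close> is attained, since that ball is compact.\<close>

definition theta_tilde ::
    "('a::euclidean_space \<Rightarrow> real) \<Rightarrow> nat \<Rightarrow> (nat \<Rightarrow> 'a \<Rightarrow> 'a) \<Rightarrow> 'a \<Rightarrow> real" where
  "theta_tilde N m g x = (INF z\<in>{z. N z \<le> 1}. max_slope m g x z)"

text \<open>In a run of the algorithm, \<open>x\<close> is the sequence of iterates and \<open>p k\<close> is the minimizer chosen
  at iteration \<open>k\<close>; the run is infinite as the stopping test never succeeds.\<close>

definition MFW_run ::
    "('a::euclidean_space \<Rightarrow> real) \<Rightarrow> 'a set \<Rightarrow> nat \<Rightarrow> (nat \<Rightarrow> 'a \<Rightarrow> 'a) \<Rightarrow> real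
      \<Rightarrow> (nat \<Rightarrow> 'a) \<Rightarrow> (nat \<Rightarrow> 'a) \<Rightarrow> bool" where
  "MFW_run N X m g L x p \<longleftrightarrow>
     x 0 \<in> X \<and>
     (\<forall>k. is_arg_min (\<lambda>y. max_slope m g (x k) (y - x k)) (\<lambda>y. y \<in> X) (p k) \<and>
        (let d = p k - x k; \<theta> = max_slope m g (x k) d; \<gamma> = min 1 (- \<theta> / (L * (N d)\<^sup>2))
         in \<theta> < 0 \<and> x (Suc k) = x k + \<gamma> *\<^sub>R d))"

definition h_hat :: "nat \<Rightarrow> (nat \<Rightarrow> 'a \<Rightarrow> real) \<Rightarrow> 'a \<Rightarrow> 'a \<Rightarrow> real" where
  "h_hat m F xs y = (MIN j\<in>{1..m}. F j y - F j xs)"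

end

theory Submission imports Defs begin

text \<open>
  Put \<open>t = - \<theta> k\<close> and \<open>n = N (d k)\<close>.  Smoothness and the step size rule decrease every objective by
  at least \<open>min t (t\<^sup>2 / (L * n\<^sup>2)) / 2\<close>; convexity gives \<open>h k \<le> t\<close>; and testing the minimality of
  \<open>p k\<close> against points of \<open>X\<close> around the midpoint of \<open>x k\<close> and \<open>p k\<close> gives \<open>\<alpha> * c / 4 * n powr q \<le> t\<close>.
  Eliminating \<open>n\<close> and \<open>t\<close> leaves the recursion
  \<open>h (k + 1) \<le> h k - min (h k / 2) (\<zeta> / L * h k powr (2 - 2 / q))\<close>.

  For \<open>q > 2\<close> put \<open>\<beta> = 1 - 2 / q\<close>.  The two terms of the minimum agree at
  \<open>\<tau> = (L / (2 * \<zeta>)) powr (1 / \<beta>)\<close>.  One step maps any bound \<open>B \<ge> \<tau>\<close> to \<open>B / 2\<close>, and \<open>k0\<close> is the first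
  \<open>k \<ge> 1\<close> with \<open>L * D\<^sup>2 / 2 ^ k < \<tau>\<close>.  Below \<open>\<tau>\<close> every step
  increases \<open>h k powr (- \<beta>)\<close> by at least \<open>\<beta> * \<zeta> / L\<close>.
\<close>

section \<open>The second norm and its diameter\<close>

lemma is_norm_bounded:
  fixes N :: "'a::euclidean_space \<Rightarrow> real"
  assumes "is_norm N"
  obtains C where "\<And>x. N x \<le> C * norm x"
proof -
  have tri: "N (x + y) \<le> N x + N y" and sc: "N (a *\<^sub>R x) = \<bar>a\<bar> * N x"
    and nonneg: "0 \<le> N x" and zero: "N 0 = 0" for x y a
    using assms unfolding is_norm_def by auto
  have sum_le: "finite A \<Longrightarrow> N (sum f A) \<le> (\<Sum>i\<in>A. N (f i))" for f and A :: "'a set"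
  proof (induction A rule: finite_induct)
    case (insert a A)
    then show ?case using tri[of "f a" "sum f A"] by simp
  qed (simp add: zero)
  have "N x \<le> (\<Sum>b\<in>Basis. N b) * norm x" for x
  proof -
    have "N x = N (\<Sum>b\<in>Basis. (x \<bullet> b) *\<^sub>R b)"
      by (simp add: euclidean_representation)
    also have "\<dots> \<le> (\<Sum>b\<in>Basis. N ((x \<bullet> b) *\<^sub>R b))"
      by (rule sum_le) simp
    also have "\<dots> \<le> (\<Sum>b\<in>Basis. N b * norm x)"
      by (rule sum_mono) (auto simp: sc mult.commute intro!: mult_left_mono nonneg Basis_le_norm)
    finally show ?thesis by (simp add: sum_distrib_right)
  qed
  then show thesis by (rule that)
qed

lemma norm_le_norm_diameter:
  fixes N :: "'a::euclidean_space \<Rightarrow> real"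
  assumes "is_norm N" "bounded X" "x \<in> X" "y \<in> X"
  shows "N (x - y) \<le> norm_diameter N X"
proof -
  obtain C where C: "\<And>x. N x \<le> C * norm x" using is_norm_bounded[OF assms(1)] by blast
  obtain B where B: "\<And>x. x \<in> X \<Longrightarrow> norm x \<le> B" using assms(2) by (auto simp: bounded_iff)
  have "N (a - b) \<le> \<bar>C\<bar> * (B + B)" if "a \<in> X" "b \<in> X" for a b
  proof -
    have "N (a - b) \<le> \<bar>C\<bar> * norm (a - b)"
      using C[of "a - b"] mult_right_mono[OF abs_ge_self[of C] norm_ge_zero[of "a - b"]] by linarith
    also have "\<dots> \<le> \<bar>C\<bar> * (B + B)"
      using norm_triangle_ineq4[of a b] B[OF that(1)] B[OF that(2)]
      by (intro mult_left_mono) linarith+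
    finally show ?thesis .
  qed
  \<comment> \<open>A real supremum dominates the members of its set only if that set is bounded
    above, so boundedness of \<open>X\<close> has to be carried over to \<open>N\<close>
    first.\<close>
  then have "bdd_above ((\<lambda>(x, y). N (x - y)) ` (X \<times> X))"
    by (intro bdd_aboveI[of _ "\<bar>C\<bar> * (B + B)"]) auto
  from cSUP_upper[OF _ this, of "(x, y)"] show ?thesis
    using assms by (simp add: norm_diameter_def)
qed

section \<open>Maximal slopes, the gap function and uniform convexity\<close>

lemma max_slope_ge:
  assumes "j \<in> {1..m}"
  shows "g j x \<bullet> v \<le> max_slope m g x v"
  using assms unfolding max_slope_def by (intro Max_ge) auto

lemma max_slope_le_iff:
  assumes "m \<ge> 1"
  shows "max_slope m g x v \<le> b \<longleftrightarrow> (\<forall>j\<in>{1..m}. g j x \<bullet> v \<le> b)"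
  using assms unfolding max_slope_def by (subst Max_le_iff) auto

lemma max_slope_zero:
  assumes "m \<ge> 1"
  shows "max_slope m g x 0 = 0"
  using assms max_slope_ge[of 1 m g x 0] max_slope_le_iff[of m g x 0 0] by auto

text \<open>A maximum of linear functionals is sublinear. This separates the slope towards a
  midpoint from that of a perturbation of it.\<close>

lemma max_slope_combination_le:
  assumes "m \<ge> 1" "a \<ge> 0" "b \<ge> 0"
  shows "max_slope m g x (a *\<^sub>R v + b *\<^sub>R w) \<le> a * max_slope m g x v + b * max_slope m g x w"
  unfolding max_slope_le_iff[OF assms(1)]
  using assms by (auto simp: inner_add_right intro!: add_mono mult_left_mono max_slope_ge)

lemma h_hat_le:
  assumes "j \<in> {1..m}"
  shows "h_hat m F xs y \<le> F j y - F j xs"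
  using assms unfolding h_hat_def by (intro Min_le) auto

lemma h_hat_attained:
  assumes "m \<ge> 1"
  obtains j where "j \<in> {1..m}" "h_hat m F xs y = F j y - F j xs"
proof -
  have "h_hat m F xs y \<in> (\<lambda>j. F j y - F j xs) ` {1..m}"
    using assms unfolding h_hat_def by (intro Min_in) auto
  then show thesis using that by auto
qed

text \<open>The \<open>N\<close>-ball of radius \<open>A\<close> around the midpoint of
  \<open>x\<close> and \<open>p\<close> lies in \<open>X\<close>. Going to the midpoint achieves
  half of the optimal slope, so optimality of \<open>p\<close> forces the other half to dominate
  \<open>A\<close> times the steepest descent over the unit ball.\<close>

lemma uniformly_convex_gap:
  fixes N :: "'a::euclidean_space \<Rightarrow> real"
  assumes "is_norm N" "m \<ge> 1" "\<alpha> > 0" "uniformly_convex_set N \<alpha> q X"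
    and "x \<in> X" "p \<in> X" "p \<noteq> x"
    and min: "\<And>y. y \<in> X \<Longrightarrow> max_slope m g x (p - x) \<le> max_slope m g x (y - x)"
  shows "\<alpha> / 4 * N (p - x) powr q * \<bar>theta_tilde N m g x\<bar> \<le> - max_slope m g x (p - x)"
proof -
  define n where "n = N (p - x)"
  \<comment> \<open>The factor \<open>\<gamma> * (1 - \<gamma>) * (\<alpha> / 2)\<close> equals
    \<open>\<alpha> / 8\<close> at the midpoint; absorbing half of \<theta> doubles it to the
    \<open>\<alpha> / 4\<close> of the claim.\<close>
  define A where "A = \<alpha> / 8 * n powr q"
  define \<theta> where "\<theta> = max_slope m g x (p - x)"
  have "n > 0" using assms(1,7) unfolding n_def is_norm_def by (metis eq_iff_diff_eq_0 less_eq_real_def)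
  then have A: "A > 0" using assms by (simp add: A_def)
  have lower: "\<theta> / (2 * A) \<le> max_slope m g x z" if "N z \<le> 1" for z
  proof -
    have "x + (1/2) *\<^sub>R (p - x) + (1/2 * (1 - 1/2) * (\<alpha> / 2) * N (p - x) powr q) *\<^sub>R z \<in> X"
      by (rule assms(4)[unfolded uniformly_convex_set_def, rule_format]) (use assms(5,6) that in auto)
    then have "x + ((1/2) *\<^sub>R (p - x) + A *\<^sub>R z) \<in> X"
      by (simp add: A_def n_def add.assoc)
    from min[OF this] have "\<theta> \<le> max_slope m g x ((1/2) *\<^sub>R (p - x) + A *\<^sub>R z)"
      by (simp add: \<theta>_def)
    also have "\<dots> \<le> 1/2 * \<theta> + A * max_slope m g x z"
      unfolding \<theta>_def using A assms(2) by (intro max_slope_combination_le) auto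
    finally show ?thesis using A by (simp add: field_simps)
  qed
  have "N 0 = 0" using assms(1) unfolding is_norm_def by blast
  then have z0: "N 0 \<le> 1" by simp
  \<comment> \<open>The lower bound just shown also makes the infimum in \<^const>\<open>theta_tilde\<close> non-junk.\<close>
  have "\<theta> / (2 * A) \<le> theta_tilde N m g x"
    unfolding theta_tilde_def using z0 lower by (intro cINF_greatest) auto
  \<comment> \<open>The competitor 0 makes the infimum nonpositive, which turns the absolute value
    into a negation.\<close>
  moreover have "theta_tilde N m g x \<le> max_slope m g x 0"
    unfolding theta_tilde_def
    using z0 lower by (intro cINF_lower bdd_belowI[of _ "\<theta> / (2 * A)"]) auto
  ultimately have "\<bar>theta_tilde N m g x\<bar> \<le> - \<theta> / (2 * A)"
    using max_slope_zero[OF assms(2), of g x] by simp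
  then have "2 * A * \<bar>theta_tilde N m g x\<bar> \<le> - \<theta>"
    using A by (simp add: field_simps)
  then show ?thesis by (simp add: A_def n_def \<theta>_def)
qed

section \<open>Scalar estimates for a single step\<close>

text \<open>Here \<open>a\<close> stands for \<open>L * (N d)\<^sup>2\<close>, and
  \<open>min 1 (t / a)\<close> minimizes the quadratic
  \<open>a / 2 * \<gamma>\<^sup>2 - \<gamma> * t\<close> over [0, 1]. The second bound is free of
  \<open>t\<close> and later gives the initial estimate \<open>L * D\<^sup>2 / 2\<close>.\<close>

lemma short_step_decrease:
  fixes t a :: real
  assumes "t > 0" "a > 0"
  shows "a / 2 * (min 1 (t / a))\<^sup>2 - min 1 (t / a) * t \<le> - min t (t\<^sup>2 / a) / 2"
    and "t + (a / 2 * (min 1 (t / a))\<^sup>2 - min 1 (t / a) * t) \<le> a / 2"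
proof -
  show "a / 2 * (min 1 (t / a))\<^sup>2 - min 1 (t / a) * t \<le> - min t (t\<^sup>2 / a) / 2"
  proof (cases "t \<ge> a")
    case True
    then have one: "min 1 (t / a) = 1" using assms by (simp add: min_def)
    have "a / 2 * 1\<^sup>2 - 1 * t \<le> - t / 2" using True by simp
    also have "\<dots> \<le> - min t (t\<^sup>2 / a) / 2" by simp
    finally show ?thesis unfolding one .
  next
    case False
    then have eq: "min 1 (t / a) = t / a" using assms by (simp add: min_def)
    have "a / 2 * (t / a)\<^sup>2 - t / a * t = - (t\<^sup>2 / a) / 2"
      using assms by (simp add: field_simps power2_eq_square)
    also have "\<dots> \<le> - min t (t\<^sup>2 / a) / 2" by simp
    finally show ?thesis unfolding eq .
  qed
  show "t + (a / 2 * (min 1 (t / a))\<^sup>2 - min 1 (t / a) * t) \<le> a / 2"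
  proof (cases "t \<ge> a")
    case False
    then have "min 1 (t / a) = t / a" using assms by (simp add: min_def)
    moreover have "a / 2 - (t + (a / 2 * (t / a)\<^sup>2 - t / a * t)) = (t - a)\<^sup>2 / (2 * a)"
      using assms by (simp add: field_simps power2_eq_square)
    moreover have "(t - a)\<^sup>2 / (2 * a) \<ge> 0" using assms by simp
    ultimately show ?thesis by simp
  qed (use assms in \<open>simp add: min_def\<close>)
qed

text \<open>Solving the hypothesis for \<open>n\<close> bounds \<open>n\<^sup>2\<close> by
  \<open>(4 * t / A) powr (2 / q)\<close>. In
  \<open>2 powr ((4 + q) / q) = 2 * 4 powr (2 / q)\<close> the 4 comes from that hypothesis; the 2
  offsets the outer factor 2, which is there because a step gains only half of the right-hand
  side.\<close>

lemma quadratic_gain_ge: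
  fixes A n q t L :: real
  assumes "A > 0" "n > 0" "q > 0" "L > 0" "A / 4 * n powr q \<le> t"
  shows "2 * (A powr (2 / q) / 2 powr ((4 + q) / q) / L * t powr (2 - 2 / q)) \<le> t\<^sup>2 / (L * n\<^sup>2)"
proof -
  have t: "t > 0"
    using assms by (smt (verit) divide_pos_pos mult_pos_pos powr_gt_zero)
  have "(n powr q) powr (2 / q) \<le> (4 * t / A) powr (2 / q)"
    using assms by (intro powr_mono2) (auto simp: field_simps)
  then have n2: "n\<^sup>2 \<le> (4 * t / A) powr (2 / q)"
    using assms by (simp add: powr_powr)
  have "(2::real) powr ((4 + q) / q) = 2 powr (2 * (2 / q) + 1)"
    using assms by (simp add: field_simps)
  also have "\<dots> = 2 * (2 powr 2) powr (2 / q)"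
    by (simp only: powr_add powr_powr) simp
  finally have four: "(2::real) powr ((4 + q) / q) = 2 * 4 powr (2 / q)" by simp
  have "t powr (2 / q) * t powr (2 - 2 / q) = t\<^sup>2"
    using t by (simp flip: powr_add)
  then have "2 * (A powr (2 / q) / 2 powr ((4 + q) / q) / L * t powr (2 - 2 / q))
      = t\<^sup>2 / (L * (4 * t / A) powr (2 / q))"
    using assms t unfolding four by (simp add: powr_divide powr_mult field_simps)
  also have "\<dots> \<le> t\<^sup>2 / (L * n\<^sup>2)"
    using assms t n2 by (intro divide_left_mono mult_left_mono mult_pos_pos) auto
  finally show ?thesis .
qed

section \<open>The scalar recursion\<close>

text \<open>Above \<tau> the minimum is \<open>s / 2\<close>, so \<open>s\<close> is halved. Below
  \<tau> the decrease may be smaller, yet the result stays under half of \<tau>; hence the maximum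
  in the claim.\<close>

lemma recursion_le_half:
  fixes s \<tau> \<beta> C :: real
  assumes "s \<ge> 0" "0 < \<beta>" "\<beta> \<le> 1" "C > 0" and \<tau>: "\<tau> = (1 / (2 * C)) powr (1 / \<beta>)"
  shows "s - min (s / 2) (C * s powr (1 + \<beta>)) \<le> max s \<tau> / 2"
proof (cases "s = 0")
  case False
  then have s: "s > 0" using assms by simp
  have \<tau>0: "\<tau> > 0" using assms by simp
  have C\<tau>: "C * \<tau> powr \<beta> = 1 / 2" using assms by (simp add: powr_powr)
  \<comment> \<open>Normalizing by \<tau> reduces the choice in the minimum to comparing
    \<open>s / \<tau>\<close> with 1.\<close>
  have eq: "C * s powr (1 + \<beta>) = s * (s / \<tau>) powr \<beta> / 2"
  proof -
    have "C * s powr (1 + \<beta>) = C * \<tau> powr \<beta> * (s * (s / \<tau>) powr \<beta>)"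
      using s \<tau>0 by (simp add: powr_add powr_divide)
    then show ?thesis using C\<tau> by simp
  qed
  show ?thesis
  proof (cases "s \<le> \<tau>") \<comment> \<open>below \<open>\<tau>\<close>, \<open>\<beta> \<le> 1\<close> reduces the claim to \<open>(s - \<tau>)\<^sup>2 \<ge> 0\<close>\<close>
    case True
    have "(s / \<tau>) powr 1 \<le> (s / \<tau>) powr \<beta>"
      using True s \<tau>0 assms by (intro powr_mono') auto
    then have "s * (s / \<tau>) / 2 \<le> C * s powr (1 + \<beta>)"
      unfolding eq using s \<tau>0 by (intro divide_right_mono mult_left_mono) auto
    moreover have "s * (s / \<tau>) / 2 \<le> s / 2" using True s \<tau>0 by (simp add: field_simps)
    moreover have "\<tau> / 2 - (s - s * (s / \<tau>) / 2) = (s - \<tau>)\<^sup>2 / (2 * \<tau>)"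
      using \<tau>0 by (simp add: field_simps power2_eq_square)
    moreover have "(s - \<tau>)\<^sup>2 / (2 * \<tau>) \<ge> 0" using \<tau>0 by simp
    ultimately show ?thesis using True by (simp add: min_def)
  next
    case False
    then have "(s / \<tau>) powr \<beta> \<ge> 1"
      using s \<tau>0 assms by (intro ge_one_powr_ge_zero) auto
    then have "s / 2 \<le> C * s powr (1 + \<beta>)"
      unfolding eq using s by simp
    then show ?thesis using False by (simp add: min_def)
  qed
qed (use assms in simp)

text \<open>With \<open>u = C * s powr \<beta>\<close> the recursion reads
  \<open>s' \<le> s * (1 - u)\<close>. Since
  \<open>(1 - u) powr (- \<beta>) \<ge> 1 + \<beta> * u\<close>, the power grows by at least
  \<open>\<beta> * u * s powr (- \<beta>)\<close>, which is the constant
  \<open>\<beta> * C\<close>.\<close>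

lemma recursion_powr_increase:
  fixes s s' \<tau> \<beta> C :: real
  assumes "0 < s'" "s' \<le> s - min (s / 2) (C * s powr (1 + \<beta>))" "s \<le> \<tau>"
    and "0 < \<beta>" "C > 0" and \<tau>: "\<tau> = (1 / (2 * C)) powr (1 / \<beta>)"
  shows "s powr (- \<beta>) + \<beta> * C \<le> s' powr (- \<beta>)"
proof -
  have s: "s > 0"
  proof (rule ccontr)
    assume "\<not> s > 0"
    \<comment> \<open>\<open>powr\<close> is nonnegative for every base, so both branches of the
      minimum would force \<open>s' \<le> 0\<close>.\<close>
    moreover have "C * s powr (1 + \<beta>) \<ge> 0" using assms by simp
    ultimately show False using assms(1,2) by (auto simp: min_def split: if_splits)
  qed
  define u where "u = C * s powr \<beta>"
  have "s powr \<beta> \<le> \<tau> powr \<beta>" using s assms by (intro powr_mono2) auto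
  also have "\<dots> = 1 / (2 * C)" using assms by (simp add: powr_powr)
  finally have u: "u \<le> 1 / 2" using assms by (simp add: u_def field_simps)
  have u0: "u > 0" using s assms by (simp add: u_def)
  have us: "C * s powr (1 + \<beta>) = s * u" using s by (simp add: u_def powr_add)
  have "s * u \<le> s / 2" using u s by simp
  then have s': "s' \<le> s * (1 - u)" using assms(2) us by (simp add: algebra_simps)
  \<comment> \<open>Bernoulli's inequality for a negative exponent, from
    \<open>ln y \<le> y - 1\<close> and \<open>1 + y \<le> exp y\<close>.\<close>
  have "1 + \<beta> * u \<le> 1 + (- \<beta> * ln (1 - u))"
    using mult_left_mono[OF ln_le_minus_one[of "1 - u"], of \<beta>] u assms by simp
  also have "\<dots> \<le> exp (- \<beta> * ln (1 - u))" by (rule exp_ge_add_one_self)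
  also have "\<dots> = (1 - u) powr (- \<beta>)" using u by (simp add: powr_def)
  finally have "s powr (- \<beta>) * (1 + \<beta> * u) \<le> s powr (- \<beta>) * (1 - u) powr (- \<beta>)"
    by (intro mult_left_mono) auto
  also have "\<dots> = (s * (1 - u)) powr (- \<beta>)" using s u by (simp add: powr_mult)
  also have "\<dots> \<le> s' powr (- \<beta>)"
    using s' assms by (intro powr_mono2') auto
  finally have *: "s powr (- \<beta>) * (1 + \<beta> * u) \<le> s' powr (- \<beta>)" .
  have "s powr (- \<beta>) * u = C" using s by (simp add: u_def powr_minus)
  then have "s powr (- \<beta>) * (1 + \<beta> * u) = s powr (- \<beta>) + \<beta> * C"
    by (simp add: algebra_simps)
  then show ?thesis using * by simp
qed

lemma recursion_rate:
  fixes h :: "nat \<Rightarrow> real" and \<beta> C :: real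
  assumes "\<And>k. h k \<ge> 0"
    and rec: "\<And>k. h (Suc k) \<le> h k - min (h k / 2) (C * h k powr (1 + \<beta>))"
    and "0 < \<beta>" "C > 0" and start: "h n \<le> (1 / (2 * C)) powr (1 / \<beta>)"
  shows "h (n + i) \<le> (1 / (C * (2 + \<beta> * i))) powr (1 / \<beta>)"
proof -
  define \<tau> where "\<tau> = (1 / (2 * C)) powr (1 / \<beta>)"
  have dec: "h (Suc k) \<le> h k" for k
  proof -
    have "min (h k / 2) (C * h k powr (1 + \<beta>)) \<ge> 0" using assms by simp
    then show ?thesis using rec[of k] by linarith
  qed
  have le\<tau>: "h (n + i) \<le> \<tau>" for i
    using start lift_Suc_antimono_le[of h n "n + i"] dec unfolding \<tau>_def by force
  \<comment> \<open>Positivity is a premise because \<open>0 powr (- \<beta>)\<close> is 0, which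
    would break the invariant; where \<open>h\<close> vanishes the final bound is trivial. The 2
    stems from \<open>\<tau> powr (- \<beta>) = 2 * C\<close>.\<close>
  have inv: "h (n + i) > 0 \<Longrightarrow> C * (2 + \<beta> * i) \<le> h (n + i) powr (- \<beta>)" for i
  proof (induction i)
    case 0
    have "\<tau> powr (- \<beta>) \<le> h n powr (- \<beta>)"
      using 0 le\<tau>[of 0] assms by (intro powr_mono2') auto
    moreover have "\<tau> powr (- \<beta>) = 2 * C"
      using assms by (simp add: \<tau>_def powr_powr powr_minus)
    ultimately show ?case by simp
  next
    case (Suc i)
    have "h (n + i) > 0" using Suc.prems dec[of "n + i"] by simp
    moreover have "h (n + i) powr (- \<beta>) + \<beta> * C \<le> h (n + Suc i) powr (- \<beta>)"
      using Suc.prems rec[of "n + i"] le\<tau>[of i] assms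
      by (intro recursion_powr_increase[OF _ _ _ _ _ \<tau>_def]) auto
    ultimately show ?case using Suc.IH by (simp add: algebra_simps)
  qed
  show ?thesis
  proof (cases "h (n + i) = 0")
    case False
    then have h: "h (n + i) > 0" using assms(1)[of "n + i"] by simp
    have pos: "C * (2 + \<beta> * i) > 0" using assms by (simp add: add_pos_nonneg)
    have "(h (n + i) powr (- \<beta>)) powr (- (1 / \<beta>)) \<le> (C * (2 + \<beta> * i)) powr (- (1 / \<beta>))"
      using inv[OF h] pos assms by (intro powr_mono2') auto
    moreover have "(h (n + i) powr (- \<beta>)) powr (- (1 / \<beta>)) = h (n + i)"
      using h assms by (simp add: powr_powr)
    moreover have "(C * (2 + \<beta> * i)) powr (- (1 / \<beta>)) = (1 / (C * (2 + \<beta> * i))) powr (1 / \<beta>)"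
      using pos by (simp add: powr_minus powr_divide inverse_eq_divide)
    ultimately show ?thesis by simp
  qed simp
qed

section \<open>The threshold index and the asymptotic order\<close>

text \<open>The left side is \<tau>, and the exponent of 2 is one more than the number rounded down
  in \<open>k0\<close>. Comparing \<open>L * D\<^sup>2 / 2 ^ k\<close> with \<tau> thus means
  comparing \<open>k\<close> with that exponent.\<close>

lemma threshold_eq:
  fixes q L D \<zeta> :: real
  assumes "q > 2" "L > 0" "D > 0" "\<zeta> > 0"
  shows "(1 / (2 * (\<zeta> / L))) powr (q / (q - 2))
    = L * D\<^sup>2 / 2 powr (2 / (q - 2) * log 2 (2 * D powr (q - 2) * \<zeta> powr (q / 2) / L) + 1)"
    (is "?l = ?r")
proof -
  define b where "b = log 2 (2 * D powr (q - 2) * \<zeta> powr (q / 2) / L)"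
  have b: "b * ln 2 = ln 2 + (q - 2) * ln D + q / 2 * ln \<zeta> - ln L"
    using assms by (simp add: b_def log_def ln_mult ln_div ln_powr)
  have "ln (2 powr (2 / (q - 2) * b + 1)) = 2 / (q - 2) * (b * ln 2) + ln (2::real)"
    by (simp add: ln_powr distrib_right)
  then have "ln ?r = ln L + 2 * ln D
      - (2 / (q - 2) * (ln 2 + (q - 2) * ln D + q / 2 * ln \<zeta> - ln L) + ln 2)"
    unfolding b b_def[symmetric] using assms by (simp add: ln_mult ln_div ln_realpow)
  also have "\<dots> = q / (q - 2) * (ln L - ln 2 - ln \<zeta>)"
    using assms by (simp add: field_simps)
  also have "\<dots> = ln ?l"
    using assms by (simp add: ln_mult ln_div ln_powr)
  finally show ?thesis using assms by (subst (asm) ln_inj_iff) auto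
qed

lemma shifted_powr_bigo:
  fixes a b u v w r :: real
  assumes "a > 0" "v > 0" "w > 0" "r \<ge> 0"
  shows "(\<lambda>k::nat. (a / (w * (u + v * (real k - b)))) powr r) \<in> O(\<lambda>k. 1 / real k powr r)"
proof (rule bigoI[where c = "(2 * a / (w * v)) powr r"])
  show "\<forall>\<^sub>F k in sequentially. norm ((a / (w * (u + v * (real k - b)))) powr r)
      \<le> (2 * a / (w * v)) powr r * norm (1 / real k powr r)"
  proof (rule eventually_mono[OF eventually_ge_at_top])
    fix k :: nat
    \<comment> \<open>From here on \<open>v * k\<close> is at least twice the total shift
      \<open>v * \<bar>b\<bar> + \<bar>u\<bar>\<close>, so half of it survives; the added 1 keeps
      \<open>k\<close> positive.\<close>
    assume "nat \<lceil>2 * (\<bar>b\<bar> + \<bar>u\<bar> / v)\<rceil> + 1 \<le> k"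
    then have k: "2 * (\<bar>b\<bar> + \<bar>u\<bar> / v) \<le> real k" "real k > 0" by linarith+
    have "v * (2 * (\<bar>b\<bar> + \<bar>u\<bar> / v)) \<le> v * real k" using k assms by (intro mult_left_mono) auto
    then have "2 * (v * \<bar>b\<bar>) + 2 * \<bar>u\<bar> \<le> v * real k" using assms by (simp add: algebra_simps)
    moreover have "v * b \<le> v * \<bar>b\<bar>" using assms by simp
    ultimately have ge: "v * real k / 2 \<le> u + v * (real k - b)"
      by (simp add: algebra_simps)
    have pos: "v * real k / 2 > 0" using k assms by simp
    have "a / (w * (u + v * (real k - b))) \<le> a / (w * (v * real k / 2))"
      using ge pos assms by (intro divide_left_mono mult_left_mono mult_pos_pos) auto
    also have "\<dots> = 2 * a / (w * v) * (1 / real k)" by (simp add: mult.commute mult.left_commute)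
    finally have "(a / (w * (u + v * (real k - b)))) powr r \<le> (2 * a / (w * v) * (1 / real k)) powr r"
      using ge pos assms by (intro powr_mono2) auto
    also have "\<dots> = (2 * a / (w * v)) powr r * (1 / real k powr r)"
      using k assms by (subst powr_mult) (auto simp: powr_divide)
    finally show "norm ((a / (w * (u + v * (real k - b)))) powr r)
      \<le> (2 * a / (w * v)) powr r * norm (1 / real k powr r)" by simp
  qed
qed

theorem theorem9:
  fixes N :: "'a::euclidean_space \<Rightarrow> real"
    and X V :: "'a set"
    and m :: nat
    and F :: "nat \<Rightarrow> 'a \<Rightarrow> real"
    and g :: "nat \<Rightarrow> 'a \<Rightarrow> 'a"
    and Lc :: "nat \<Rightarrow> real"
    and x p :: "nat \<Rightarrow> 'a"
    and xs :: 'a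
    and L D \<alpha> q c \<zeta> :: real
    and k0 :: int
    and d :: "nat \<Rightarrow> 'a"
    and \<theta> h :: "nat \<Rightarrow> real"
  assumes "is_norm N"
    and "X \<noteq> {}" "convex X" "compact X"
    and "open V" "X \<subseteq> V"
    and "m \<ge> 1"
    and "\<And>j. j \<in> {1..m} \<Longrightarrow> convex_fun_on V (F j)"
    and "\<And>j. j \<in> {1..m} \<Longrightarrow> cont_diff_with_gradient V (F j) (g j)"
    and "\<And>j. j \<in> {1..m} \<Longrightarrow> smooth_over N X (F j) (g j) (Lc j)"
    and "L = (MAX j\<in>{1..m}. Lc j)" "L > 0"
    and "D = norm_diameter N X"
    and "MFW_run N X m g L x p"
    and "d = (\<lambda>k. p k - x k)"
    and "\<theta> = (\<lambda>k. max_slope m g (x k) (d k))"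
    and "\<exists>r. strict_mono r \<and> (x \<circ> r) \<longlonglongrightarrow> xs"
    and "h = (\<lambda>k. h_hat m F xs (x k))"
    and "\<alpha> > 0" "q \<ge> 2" "uniformly_convex_set N \<alpha> q X"
    and "c = (INF k. \<bar>theta_tilde N m g (x k)\<bar>)" "c > 0"
    and "\<zeta> = (\<alpha> * c) powr (2 / q) / 2 powr ((4 + q) / q)"
    and "k0 = max (\<lfloor>2 / (q - 2) * log 2 (2 * D powr (q - 2) * \<zeta> powr (q / 2) / L)\<rfloor> + 2) 1"
  shows "(q = 2 \<longrightarrow> (\<forall>k\<ge>1. h k \<le> max (1 / 2) (1 - \<zeta> / L) * h (k - 1))) \<and>
    (q > 2 \<longrightarrow>
       (\<forall>k\<ge>1. int k \<le> k0 \<longrightarrow> h k \<le> L * D\<^sup>2 / 2 ^ k) \<and>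
       (\<forall>k. int k > k0 \<longrightarrow>
          h k \<le> (q * L / (\<zeta> * (2 * q + (q - 2) * (real k - real_of_int k0)))) powr (q / (q - 2))) \<and>
       (\<lambda>k::nat. (q * L / (\<zeta> * (2 * q + (q - 2) * (real k - real_of_int k0)))) powr (q / (q - 2)))
         \<in> O(\<lambda>k. 1 / real k powr (q / (q - 2)))) \<and>
    (\<forall>l\<ge>1. \<forall>k\<ge>l.
       (\<Sum>i=l..k. min \<bar>\<theta> i\<bar> (\<bar>\<theta> i\<bar>\<^sup>2 / (L * (N (d i))\<^sup>2))) \<le> 2 * h l)"
proof -
  let ?C = "\<zeta> / L"

  \<comment> \<open>Basic properties of the run\<close>
  have N: "N v \<ge> 0" "N v = 0 \<longleftrightarrow> v = 0" for v
    using assms(1) by (auto simp: is_norm_def)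
  define \<gamma> where "\<gamma> k = min 1 (- \<theta> k / (L * (N (d k))\<^sup>2))" for k
  have x0: "x 0 \<in> X" and neg: "\<theta> k < 0" and step: "x (Suc k) = x k + \<gamma> k *\<^sub>R d k"
    and pX: "p k \<in> X"
    and pmin: "\<And>y. y \<in> X \<Longrightarrow> max_slope m g (x k) (p k - x k) \<le> max_slope m g (x k) (y - x k)"
    for k
    using assms(14) unfolding MFW_run_def assms(15,16) \<gamma>_def Let_def is_arg_min_linorder by auto
  \<comment> \<open>A zero direction has slope 0, whereas \<theta> is negative; this makes the
    divisions by \<open>N (d k)\<close> meaningful.\<close>
  have d0: "d k \<noteq> 0" for k
    using neg[of k] max_slope_zero[OF assms(7), of g "x k"] unfolding assms(16) by auto
  have Nd: "N (d k) > 0" for k using N[of "d k"] d0[of k] by linarith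
  have a0: "L * (N (d k))\<^sup>2 > 0" for k using Nd[of k] \<open>L > 0\<close> by simp
  have \<gamma>: "0 \<le> \<gamma> k" "\<gamma> k \<le> 1" for k
    using neg[of k] a0[of k] by (auto simp: \<gamma>_def intro!: divide_nonpos_pos)
  have xX: "x k \<in> X" for k
  proof (induction k)
    case (Suc k)
    have "x (Suc k) = (1 - \<gamma> k) *\<^sub>R x k + \<gamma> k *\<^sub>R p k"
      unfolding step assms(15) by (simp add: algebra_simps)
    then show ?case
      using \<open>convex X\<close> Suc pX[of k] \<gamma>[of k] by (auto intro!: convexD)
  qed (rule x0)
  have ND: "N (d k) \<le> D" for k
    unfolding assms(13,15) using assms(1,4) xX pX
    by (intro norm_le_norm_diameter compact_imp_bounded) auto
  have D: "D > 0" using Nd[of 0] ND[of 0] by linarith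

  \<comment> \<open>Descent of the objectives\<close>
  define \<delta> where "\<delta> k = L * (N (d k))\<^sup>2 / 2 * (\<gamma> k)\<^sup>2 - \<gamma> k * - \<theta> k" for k
  \<comment> \<open>The bound \<open>\<delta> k\<close> is the same for all objectives, which is
    what lets it pass to their minimum \<open>h\<close>.\<close>
  have descent: "F j (x (Suc k)) \<le> F j (x k) + \<delta> k" if j: "j \<in> {1..m}" for j k
  proof -
    have "F j (x (Suc k)) \<le> F j (x k) + g j (x k) \<bullet> (x (Suc k) - x k)
        + Lc j / 2 * (N (x (Suc k) - x k))\<^sup>2"
      using assms(10)[OF j] xX unfolding smooth_over_def by blast
    also have "x (Suc k) - x k = \<gamma> k *\<^sub>R d k" by (simp add: step)
    also have "N (\<gamma> k *\<^sub>R d k) = \<gamma> k * N (d k)"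
      using assms(1) \<gamma>[of k] by (simp add: is_norm_def)
    also have "g j (x k) \<bullet> (\<gamma> k *\<^sub>R d k) \<le> \<gamma> k * \<theta> k"
      using \<gamma>[of k] by (auto simp: assms(16) intro!: mult_left_mono max_slope_ge[OF j])
    also have "Lc j / 2 * (\<gamma> k * N (d k))\<^sup>2 \<le> L / 2 * (\<gamma> k * N (d k))\<^sup>2"
      using j unfolding assms(11) by (intro mult_right_mono divide_right_mono Max_ge) auto
    finally show ?thesis by (simp add: \<delta>_def power_mult_distrib algebra_simps)
  qed
  define \<mu> where "\<mu> k = min \<bar>\<theta> k\<bar> (\<bar>\<theta> k\<bar>\<^sup>2 / (L * (N (d k))\<^sup>2))" for k
  have \<mu>0: "\<mu> k \<ge> 0" for k using a0[of k] by (auto simp: \<mu>_def)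
  have \<delta>: "\<delta> k \<le> - \<mu> k / 2" "- \<theta> k + \<delta> k \<le> L * (N (d k))\<^sup>2 / 2" for k
    using short_step_decrease[of "- \<theta> k" "L * (N (d k))\<^sup>2"] neg[of k] a0[of k]
    unfolding \<delta>_def \<mu>_def \<gamma>_def by auto

  \<comment> \<open>The limit point and the gap \<open>h\<close>\<close>
  obtain r where r: "strict_mono r" "(x \<circ> r) \<longlonglongrightarrow> xs" using assms(17) by blast
  have xsX: "xs \<in> X"
    using closed_sequentially[OF compact_imp_closed[OF assms(4)] _ r(2)] xX by auto
  have limit_le: "F j xs \<le> F j (x k)" if j: "j \<in> {1..m}" for j k
  proof -
    \<comment> \<open>Only a subsequence is known to approach \<open>xs\<close>, but the objective
      values decrease along the whole run, so their subsequential limit lies below all of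
      them.\<close>
    have "decseq (\<lambda>k. F j (x k))"
    proof (rule decseq_SucI)
      fix n
      show "F j (x (Suc n)) \<le> F j (x n)"
        using descent[OF j, of n] \<delta>(1)[of n] \<mu>0[of n] by linarith
    qed
    then have mono: "F j (x (r n)) \<le> F j (x k)" if "n \<ge> k" for n
      using that seq_suble[OF r(1), of n] by (auto simp: decseq_def)
    have "isCont (F j) xs"
      using assms(6) assms(9)[OF j] xsX unfolding cont_diff_with_gradient_def gderiv_def
      by (auto intro: has_derivative_continuous)
    then have "(\<lambda>n. F j (x (r n))) \<longlonglongrightarrow> F j xs"
      using r(2) by (auto dest: isCont_tendsto_compose simp: o_def)
    then show ?thesis
      by (rule LIMSEQ_le_const2) (use mono in blast)
  qed
  have h_attained: "\<exists>j\<in>{1..m}. h k = F j (x k) - F j xs" for k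
  proof -
    obtain j where "j \<in> {1..m}" "h_hat m F xs (x k) = F j (x k) - F j xs"
      by (rule h_hat_attained[OF assms(7)])
    then show ?thesis unfolding assms(18) by blast
  qed
  have h_le_diff: "h k \<le> F j (x k) - F j xs" if "j \<in> {1..m}" for j k
    using h_hat_le[OF that] by (simp add: assms(18))
  have h0: "h k \<ge> 0" for k
  proof -
    obtain j where "j \<in> {1..m}" "h k = F j (x k) - F j xs" using h_attained by blast
    then show ?thesis using limit_le[of j k] by simp
  qed
  \<comment> \<open>An objective attaining the minimum at \<open>k\<close> bounds the minimum at the
    next iterate from above.\<close>
  have h_dec: "h (Suc k) \<le> h k + \<delta> k" for k
  proof -
    obtain j where j: "j \<in> {1..m}" "h k = F j (x k) - F j xs"
      using h_attained by blast
    then show ?thesis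
      using h_le_diff[OF j(1), of "Suc k"] descent[OF j(1), of k] by simp
  qed
  have h_le: "h k \<le> - \<theta> k" for k
  proof -
    \<comment> \<open>\<open>xs\<close> serves as test point for the minimality of
      \<open>p k\<close>. Every objective has gap at least \<open>h k\<close>, so the gradient
      inequality bounds all slopes at once.\<close>
    have "max_slope m g (x k) (xs - x k) \<le> - h k"
    proof (subst max_slope_le_iff[OF assms(7)], rule ballI)
      fix j assume j: "j \<in> {1..m}"
      have "F j (x k) + g j (x k) \<bullet> (xs - x k) \<le> F j xs"
        using assms(10)[OF j] xX xsX unfolding smooth_over_def by blast
      then show "g j (x k) \<bullet> (xs - x k) \<le> - h k"
        using h_le_diff[OF j, of k] by simp
    qed
    then show ?thesis using pmin[OF xsX, of k] by (simp add: assms(15,16))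
  qed

  \<comment> \<open>The recursion for \<open>h\<close>\<close>
  have \<zeta>: "\<zeta> > 0" using assms(19,23,24) by simp
  have C: "?C > 0" using \<zeta> \<open>L > 0\<close> by simp
  have gap: "\<alpha> * c / 4 * N (d k) powr q \<le> - \<theta> k" for k
  proof -
    have "c \<le> \<bar>theta_tilde N m g (x k)\<bar>"
      unfolding assms(22) by (intro cINF_lower bdd_belowI[of _ 0]) auto
    then have "\<alpha> / 4 * N (d k) powr q * c \<le> \<alpha> / 4 * N (d k) powr q * \<bar>theta_tilde N m g (x k)\<bar>"
      using \<open>\<alpha> > 0\<close> by (intro mult_left_mono) auto
    also have "\<dots> \<le> - \<theta> k"
      unfolding assms(15,16) using xX pX d0[of k] pmin assms(1,7,19,21)
      by (intro uniformly_convex_gap[of N m \<alpha> q X]) (auto simp: assms(15))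
    finally show ?thesis by (simp add: mult_ac)
  qed
  have rec: "h (Suc k) \<le> h k - min (h k / 2) (?C * h k powr (2 - 2 / q))" for k
  proof -
    have "2 * (?C * (- \<theta> k) powr (2 - 2 / q)) \<le> (- \<theta> k)\<^sup>2 / (L * (N (d k))\<^sup>2)"
      unfolding assms(24)
      using assms(12,19,20,23) Nd[of k] gap[of k] by (intro quadratic_gain_ge) auto
    moreover have "?C * h k powr (2 - 2 / q) \<le> ?C * (- \<theta> k) powr (2 - 2 / q)"
      using C h0[of k] h_le[of k] \<open>q \<ge> 2\<close> by (intro mult_left_mono powr_mono2) (auto simp: field_simps)
    \<comment> \<open>The two entries of \<mu> dominate twice the two terms of the recursion; the
      factor 2 is spent on \<open>\<delta> k \<le> - \<mu> k / 2\<close>.\<close>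
    ultimately have "2 * min (h k / 2) (?C * h k powr (2 - 2 / q)) \<le> \<mu> k"
      using h_le[of k] neg[of k] unfolding \<mu>_def by auto
    then show ?thesis using h_dec[of k] \<delta>(1)[of k] by linarith
  qed

  \<comment> \<open>Linear rate for \<open>q = 2\<close>\<close>
  have linear: "h k \<le> max (1 / 2) (1 - ?C) * h (k - 1)" if q2: "q = 2" and k: "k \<ge> 1" for k
  proof -
    obtain n where n: "k = Suc n" using k by (cases k) auto
    \<comment> \<open>The exponent \<open>2 - 2 / q\<close> is 1 here, and
      \<open>h n powr 1 = h n\<close> relies on \<open>h n \<ge> 0\<close>.\<close>
    have "h (Suc n) \<le> h n - min (h n / 2) (?C * h n)"
      using rec[of n] h0[of n] q2 by simp
    also have "\<dots> \<le> max (1 / 2) (1 - ?C) * h n"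
    proof (cases "h n / 2 \<le> ?C * h n")
      case True
      have "1 / 2 * h n \<le> max (1 / 2) (1 - ?C) * h n" using h0[of n] by (intro mult_right_mono) auto
      with True show ?thesis by (simp add: min_absorb1)
    next
      case False
      have "(1 - ?C) * h n \<le> max (1 / 2) (1 - ?C) * h n" using h0[of n] by (intro mult_right_mono) auto
      with False show ?thesis by (simp add: min_absorb2 left_diff_distrib)
    qed
    finally show ?thesis by (simp add: n)
  qed

  \<comment> \<open>Sublinear rate for \<open>q > 2\<close>\<close>
  have sublinear:
    "(\<forall>k\<ge>1. int k \<le> k0 \<longrightarrow> h k \<le> L * D\<^sup>2 / 2 ^ k) \<and>
     (\<forall>k. int k > k0 \<longrightarrow>
       h k \<le> (q * L / (\<zeta> * (2 * q + (q - 2) * (real k - real_of_int k0)))) powr (q / (q - 2)))"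
    if q: "q > 2"
  proof -
    define \<beta> where "\<beta> = (q - 2) / q"
    have \<beta>: "0 < \<beta>" "\<beta> \<le> 1" "1 / \<beta> = q / (q - 2)" "2 - 2 / q = 1 + \<beta>"
      using q by (auto simp: \<beta>_def field_simps)
    define M where "M = 2 / (q - 2) * log 2 (2 * D powr (q - 2) * \<zeta> powr (q / 2) / L)"
    define \<tau> where "\<tau> = (1 / (2 * ?C)) powr (1 / \<beta>)"
    have \<tau>: "\<tau> = L * D\<^sup>2 / 2 powr (M + 1)"
      unfolding \<tau>_def \<beta>(3) M_def using q assms(12) D \<zeta> by (rule threshold_eq)
    have k0: "k0 = max (\<lfloor>M\<rfloor> + 2) 1" using assms(25) by (simp add: M_def)
    have init: "h (Suc k) \<le> L * D\<^sup>2 / 2" for k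
    proof -
      have "h (Suc k) \<le> L * (N (d k))\<^sup>2 / 2" using h_dec[of k] h_le[of k] \<delta>(2)[of k] by linarith
      also have "\<dots> \<le> L * D\<^sup>2 / 2"
        using ND[of k] N(1)[of "d k"] \<open>L > 0\<close> by (intro divide_right_mono mult_left_mono power_mono) auto
      finally show ?thesis .
    qed
    have early: "int k \<le> k0 \<Longrightarrow> h k \<le> L * D\<^sup>2 / 2 ^ k" if "k \<ge> 1" for k
      using that
    proof (induction k rule: dec_induct)
      case base
      then show ?case using init[of 0] by simp
    next
      case (step n)
      \<comment> \<open>Since \<open>Suc n\<close> is at least 2, the 1 in the maximum defining
        \<open>k0\<close> is not what admits it, so \<open>n\<close> is at most the floor of
        \<open>M\<close> plus 1. Hence the current bound is still above \<tau> and may be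
        halved.\<close>
      have "real n \<le> M + 1" using step k0 by linarith
      then have "2 ^ n \<le> 2 powr (M + 1)" by (simp flip: powr_realpow)
      then have "\<tau> \<le> L * D\<^sup>2 / 2 ^ n"
        unfolding \<tau> using \<open>L > 0\<close> by (intro divide_left_mono) auto
      moreover have "h n \<le> L * D\<^sup>2 / 2 ^ n" using step by simp
      moreover have "h (Suc n) \<le> max (h n) \<tau> / 2"
        using rec[of n] recursion_le_half[OF h0 \<beta>(1,2) C \<tau>_def, of n] \<beta>(4) by simp
      ultimately show ?case by simp
    qed
    define n where "n = nat k0"
    have n: "n \<ge> 1" "int n = k0" using k0 by (auto simp: n_def)
    \<comment> \<open>The offset 2 in \<open>k0\<close> makes it exceed \<open>M + 1\<close>, so the
      geometric bound has dropped to \<tau> at index \<open>k0\<close>, where the second phase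
      starts.\<close>
    have "M + 1 \<le> real n" using n(2) k0 by linarith
    then have "2 powr (M + 1) \<le> 2 ^ n" by (simp flip: powr_realpow)
    then have "L * D\<^sup>2 / 2 ^ n \<le> \<tau>"
      unfolding \<tau> using \<open>L > 0\<close> by (intro divide_left_mono) auto
    then have start: "h n \<le> (1 / (2 * ?C)) powr (1 / \<beta>)" using early[OF n(1)] n(2) \<tau>_def by simp
    have late: "h k \<le> (q * L / (\<zeta> * (2 * q + (q - 2) * (real k - real_of_int k0)))) powr (q / (q - 2))"
      if k: "int k > k0" for k
    proof -
      define i where "i = k - n"
      have i: "k = n + i" using k n(2) unfolding i_def by linarith
      have "h (n + i) \<le> (1 / (?C * (2 + \<beta> * i))) powr (1 / \<beta>)"
        using rec \<beta>(4) by (intro recursion_rate h0 \<beta>(1) C start) simp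
      moreover have "real k - real_of_int k0 = i" using i n(2) by linarith
      \<comment> \<open>Expanding the fraction by \<open>q\<close> turns \<beta> into
        \<open>q - 2\<close> and 2 into \<open>2 * q\<close>.\<close>
      moreover have "1 / (?C * (2 + \<beta> * i)) = q * L / (\<zeta> * (2 * q + (q - 2) * i))"
        using q by (simp add: \<beta>_def field_simps)
      ultimately show ?thesis using i \<beta>(3) by simp
    qed
    show ?thesis using early late by blast
  qed

  \<comment> \<open>The summed decrease\<close>
  have summed: "(\<Sum>i=l..k. \<mu> i) \<le> 2 * h l" if "k \<ge> l" for k l
  proof -
    \<comment> \<open>Each \<open>\<mu> i\<close> is at most \<open>2 * (h i - h (Suc i))\<close>,
      so the sum telescopes; keeping the last term makes the induction work.\<close>
    have "(\<Sum>i=l..k. \<mu> i) \<le> 2 * (h l - h (Suc k))"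
      using that
    proof (induction k rule: dec_induct)
      case base
      then show ?case using h_dec[of l] \<delta>(1)[of l] by simp
    next
      case (step n)
      then show ?case using h_dec[of "Suc n"] \<delta>(1)[of "Suc n"] by simp
    qed
    then show ?thesis using h0[of "Suc k"] by simp
  qed

  show ?thesis
    using linear sublinear summed
      shifted_powr_bigo[of "q * L" "q - 2" \<zeta> "q / (q - 2)" "2 * q" "real_of_int k0"]
      \<open>L > 0\<close> \<zeta> unfolding \<mu>_def by (intro conjI impI) simp_all
qed

end
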